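(* Let $X$ be a real Banach space with $\dim X\geqslant 2$. Then: (i) If $X$ is not uniformly non-square, then $L_X(t)=2t^2-4t+2$ for every $t\in[0,\frac12)$. (ii) If $L_X(t_0)<\frac{4t_0^2-8t_0+5}{4}$ for some $t_0\in[0,\frac12)$, then $X$ has uniform normal structure. (iii) If $L_X(t_0)<\frac{9(1-2t_0)^2}{8}$ for some $t_0\in[0,\frac12)$, then $X$ has normal structure.
   Context: For $x,y$ in a real Banach space $X$, isosceles orthogonality $x\perp_I y$ means $\|x+y\|=\|x-y\|$. For $0\leqslant t<\frac12$ define $$L_X(t)=\sup\left\{\frac{\|tx+(1-t)y\|^2+\|(1-t)x+ty\|^2}{\|x+y\|^2}: x,y\in X,\ (x,y)\neq(0,0),\ x\perp_I y\right\}.$$ Let $S_X=\{x\in X:\|x\|=1\}$. $X$ is uniformly non-square if there exists $\delta\in(0,1)$ such that for all $x,y\in S_X$, $\|x+y\|\leqslant2(1-\delta)$ or $\|x-y\|\leqslant2(1-\delta)$. For $K\subset X$ write $d(K)=\sup\{\|x-y\|:x,y\in K\}$. $X$ has normal structure if for every closed, bounded, convex subset $K$ of $X$ containing more than one point there is a point $x_0\in K$ with $\sup\{\|x_0-y\|:y\in K\}<d(K)$. $X$ has uniform normal structure if there is a constant $0<c<1$ such that for every closed, bounded, convex subset $K$ of $X$ containing more than one point there is a point $x_0\in K$ with $\sup\{\|x_0-y\|:y\in K\}<c\,d(K)$. *)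

theory Defs
  imports "HOL-Analysis.Analysis"
begin

definition isosceles_orth :: "'a::real_normed_vector \<Rightarrow> 'a \<Rightarrow> bool" (infix "\<bottom>\<^sub>I" 50)
  where "x \<bottom>\<^sub>I y \<longleftrightarrow> norm (x + y) = norm (x - y)"

text \<open>A property of the space is a property of a type, passed as \<open>TYPE('a)\<close>.
  Isosceles orthogonality together with \<open>(x, y) \<noteq> (0, 0)\<close> forces \<open>x + y \<noteq> 0\<close>, so there is no
  division by zero; every quotient is at most 2 for \<open>0 \<le> t \<le> 1\<close>, since
  \<open>norm x\<close> and \<open>norm y\<close> are at most \<open>norm (x + y)\<close>, so the real supremum is a
  genuine one on any nontrivial space.\<close>

definition L_const :: "'a::real_normed_vector itself \<Rightarrow> real \<Rightarrow> real"
  where "L_const X t =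
    Sup {((norm (t *\<^sub>R x + (1 - t) *\<^sub>R y))\<^sup>2 + (norm ((1 - t) *\<^sub>R x + t *\<^sub>R y))\<^sup>2) / (norm (x + y))\<^sup>2
         | x y :: 'a. (x, y) \<noteq> (0, 0) \<and> x \<bottom>\<^sub>I y}"

definition uniformly_non_square :: "'a::real_normed_vector itself \<Rightarrow> bool"
  where "uniformly_non_square X \<longleftrightarrow>
    (\<exists>\<delta>::real. 0 < \<delta> \<and> \<delta> < 1 \<and>
      (\<forall>x\<in>sphere (0::'a) 1. \<forall>y\<in>sphere (0::'a) 1.
        norm (x + y) \<le> 2 * (1 - \<delta>) \<or> norm (x - y) \<le> 2 * (1 - \<delta>)))"

text \<open>On bounded nonempty sets, the library's \<^const>\<open>diameter\<close> is the supremum of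
  the distances \<open>norm (x - y)\<close>.\<close>

definition normal_structure :: "'a::real_normed_vector itself \<Rightarrow> bool"
  where "normal_structure X \<longleftrightarrow>
    (\<forall>K::'a set. closed K \<and> bounded K \<and> convex K \<and> (\<exists>x\<in>K. \<exists>y\<in>K. x \<noteq> y) \<longrightarrow>
      (\<exists>x\<^sub>0\<in>K. (SUP y\<in>K. norm (x\<^sub>0 - y)) < diameter K))"

definition uniform_normal_structure :: "'a::real_normed_vector itself \<Rightarrow> bool"
  where "uniform_normal_structure X \<longleftrightarrow>
    (\<exists>c::real. 0 < c \<and> c < 1 \<and>
      (\<forall>K::'a set. closed K \<and> bounded K \<and> convex K \<and> (\<exists>x\<in>K. \<exists>y\<in>K. x \<noteq> y) \<longrightarrow>
        (\<exists>x\<^sub>0\<in>K. (SUP y\<in>K. norm (x\<^sub>0 - y)) < c * diameter K)))"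

end

theory Submission
  imports Defs
begin

text \<open>With \<open>s = 1 - 2 * t\<close>, \<open>u = x + y\<close> and \<open>v = x - y\<close>, the number \<open>4 * L(t)\<close> is the supremum of
  \<open>norm (u + s v)^2 + norm (u - s v)^2\<close> over unit vectors \<open>u\<close>, \<open>v\<close>. This gives (i) at once, and (iii)
  follows from (ii) because \<open>9 s^2 / 2 \<le> 1 + (1 + s)^2\<close>.

  For (ii), a space without uniform normal structure contains sequences of diameter at most 1 whose
  \<open>n\<close>-th term is almost at distance 1 from the convex hull of the previous ones. A limit of the
  norms along these sequences is a seminorm \<open>p\<close> with a sequence \<open>e\<close> for which the distances are
  exactly 1, and for which \<open>p (u + s v)^2 + p (u - s v)^2 < 1 + (1 + s)^2\<close> uniformly on the unit ball
  of \<open>p\<close>. Let \<open>D k\<close> be the convex hull of \<open>e k, e (k + 1), \<dots>\<close>. If no point is \<open>p\<close>-close to all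
  the \<open>D k\<close>, choose \<open>y\<close> almost minimising the limit of its distances to the \<open>D k\<close>, and
  \<open>w1\<close>, \<open>w2\<close> far out and almost nearest to \<open>y\<close>: the pair \<open>w2 - y\<close>, \<open>w1 - y\<close> violates the bound. Otherwise
  some \<open>b \<in> D 0\<close> is close to all the \<open>D k\<close>, and a pair \<open>e n - e m\<close>, \<open>e n - b\<close> with \<open>n > m\<close> violates it.
  These two alternatives take the place of the weak limits that reflexivity would provide.\<close>

section \<open>Seminorms with a diametral sequence\<close>

text \<open>Carries bounds from the terms of a sequence to their convex hull. The affine map covers
  both later uses, \<open>e n - z\<close> and \<open>(1 - s) z + (s b - e m)\<close>.\<close>

lemma convex_seminorm_le:
  fixes p :: "'v::real_vector \<Rightarrow> real"
  assumes tri: "\<And>u v. p (u + v) \<le> p u + p v" and hom: "\<And>c u. p (c *\<^sub>R u) = \<bar>c\<bar> * p u"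
  shows "convex {z. p (a *\<^sub>R z + b) \<le> r}"
proof (rule convexI)
  fix x y and \<alpha> \<beta> :: real
  assume xy: "x \<in> {z. p (a *\<^sub>R z + b) \<le> r}" "y \<in> {z. p (a *\<^sub>R z + b) \<le> r}"
    and c: "0 \<le> \<alpha>" "0 \<le> \<beta>" "\<alpha> + \<beta> = 1"
  have "a *\<^sub>R (\<alpha> *\<^sub>R x + \<beta> *\<^sub>R y) + b = a *\<^sub>R (\<alpha> *\<^sub>R x + \<beta> *\<^sub>R y) + (\<alpha> + \<beta>) *\<^sub>R b"
    using c by simp
  also have "\<dots> = \<alpha> *\<^sub>R (a *\<^sub>R x + b) + \<beta> *\<^sub>R (a *\<^sub>R y + b)"
    by (simp add: algebra_simps)
  finally have "p (a *\<^sub>R (\<alpha> *\<^sub>R x + \<beta> *\<^sub>R y) + b) \<le> \<alpha> * p (a *\<^sub>R x + b) + \<beta> * p (a *\<^sub>R y + b)"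
    using tri[of "\<alpha> *\<^sub>R (a *\<^sub>R x + b)" "\<beta> *\<^sub>R (a *\<^sub>R y + b)"] c by (simp add: hom)
  also have "\<dots> \<le> r"
    using xy c by (intro convex_bound_le) auto
  finally show "\<alpha> *\<^sub>R x + \<beta> *\<^sub>R y \<in> {z. p (a *\<^sub>R z + b) \<le> r}" by simp
qed

text \<open>If this fails, the \<open>\<Theta>\<close> of the proof is the infimum over \<open>y\<close> of the limit of the distances
  from \<open>y\<close> to the tails, and it is positive.\<close>

lemma tails_have_approximate_center:
  fixes p :: "'v::real_vector \<Rightarrow> real" and e :: "nat \<Rightarrow> 'v"
  assumes tri: "\<And>u v. p (u + v) \<le> p u + p v" and hom: "\<And>c u. p (c *\<^sub>R u) = \<bar>c\<bar> * p u"
    and s: "0 \<le> s" and A: "0 \<le> A" "A < 1 + (1 + s)\<^sup>2"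
    and bound: "\<And>u v. (p (u + s *\<^sub>R v))\<^sup>2 + (p (u - s *\<^sub>R v))\<^sup>2 \<le> A * (max (p u) (p v))\<^sup>2"
    and diam: "\<And>i j. p (e i - e j) \<le> 1"
    and \<eta>: "0 < \<eta>"
  shows "\<exists>y. \<forall>k. \<exists>w\<in>convex hull (e ` {k..}). p (w - y) < \<eta>"
proof (rule ccontr)
  let ?D = "\<lambda>k. convex hull (e ` {k..})"
  define far where "far = {\<theta>. \<forall>y. \<exists>k. \<forall>w\<in>?D k. \<theta> \<le> p (w - y)}"
  assume "\<nexists>y. \<forall>k. \<exists>w\<in>?D k. p (w - y) < \<eta>"
  then have \<eta>_far: "\<eta> \<in> far"
    unfolding far_def by (auto simp: not_less)
  have eD: "e k \<in> ?D k" for k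
    by (simp add: hull_inc)
  have le1: "\<theta> \<le> 1" if \<theta>: "\<theta> \<in> far" for \<theta>
  proof -
    obtain k where "\<forall>w\<in>?D k. \<theta> \<le> p (w - e 0)"
      using \<theta> unfolding far_def by blast
    then have "\<theta> \<le> p (e k - e 0)" using eD by blast
    then show ?thesis using diam[of k 0] by linarith
  qed
  define \<Theta> where "\<Theta> = Sup far"
  have bdd: "bdd_above far" using le1 by (auto simp: bdd_above_def)
  have \<Theta>: "0 < \<Theta>"
    using cSup_upper[OF \<eta>_far bdd] \<eta> by (simp add: \<Theta>_def)
  define B where "B = 1 + (1 + s)\<^sup>2"
  \<comment> \<open>The slack \<open>\<kappa>\<close> replaces exact minimisers: every centre has a
    tail at distance at least \<open>lo\<close>, and some centre has points of every tail within
    \<open>hi\<close>.\<close>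
  have key: "B * (1 - \<kappa>)\<^sup>2 \<le> A * (1 + \<kappa>)\<^sup>2" if \<kappa>: "0 < \<kappa>" "\<kappa> < 1" for \<kappa>
  proof -
    define lo hi where "lo = \<Theta> * (1 - \<kappa>)" and "hi = \<Theta> * (1 + \<kappa>)"
    have lohi: "0 < lo" "lo < \<Theta>" "\<Theta> < hi"
      using \<kappa> \<Theta> by (auto simp: lo_def hi_def)
    obtain \<theta> where "\<theta> \<in> far" "lo < \<theta>"
      using lohi(2) \<eta>_far less_cSupE[of lo far] unfolding \<Theta>_def by blast
    then have lo: "\<exists>k. \<forall>w\<in>?D k. lo \<le> p (w - y)" for y
      unfolding far_def by (smt (verit) mem_Collect_eq)
    have "hi \<notin> far"
      using cSup_upper[OF _ bdd, of hi] lohi by (auto simp: \<Theta>_def)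
    then obtain y where y: "\<And>k. \<exists>w\<in>?D k. p (w - y) < hi"
      unfolding far_def by (auto simp: not_le)
    obtain k0 where k0: "\<And>w. w \<in> ?D k0 \<Longrightarrow> lo \<le> p (w - y)" using lo by blast
    obtain w1 where w1: "w1 \<in> ?D k0" "p (w1 - y) < hi" using y by blast
    \<comment> \<open>This second centre depends on \<open>w1\<close>, so \<open>w2\<close> is
      chosen afterwards, beyond both indices; its difference from the second centre is
      \<open>?u - s ?v\<close>.\<close>
    obtain k1 where k1: "\<And>w. w \<in> ?D k1 \<Longrightarrow> lo \<le> p (w - (y + s *\<^sub>R (w1 - y)))" using lo by blast
    obtain w2 where w2: "w2 \<in> ?D (max k0 k1)" "p (w2 - y) < hi" using y by blast
    have sub: "?D (max k0 k1) \<subseteq> ?D k0" "?D (max k0 k1) \<subseteq> ?D k1"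
      by (intro hull_mono image_mono; auto)+
    let ?u = "w2 - y" and ?v = "w1 - y"
    \<comment> \<open>Divided by \<open>1 + s\<close>, the vector \<open>?u + s ?v\<close> is the
      difference between a convex combination of \<open>w2\<close>, \<open>w1\<close> and
      \<open>y\<close>.\<close>
    have "(1 / (1 + s)) *\<^sub>R w2 + (s / (1 + s)) *\<^sub>R w1 \<in> ?D k0"
      using sub w1 w2 s by (intro convexD convex_convex_hull) (auto simp: field_simps)
    then have "lo \<le> p ((1 / (1 + s)) *\<^sub>R w2 + (s / (1 + s)) *\<^sub>R w1 - y)" by (rule k0)
    also have "(1 / (1 + s)) *\<^sub>R w2 + (s / (1 + s)) *\<^sub>R w1 - y
        = (1 / (1 + s)) *\<^sub>R w2 + (s / (1 + s)) *\<^sub>R w1 - (1 / (1 + s) + s / (1 + s)) *\<^sub>R y"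
      using s by (simp add: add_divide_distrib[symmetric])
    also have "\<dots> = (1 / (1 + s)) *\<^sub>R (?u + s *\<^sub>R ?v)"
      by (simp add: algebra_simps)
    also have "p \<dots> = p (?u + s *\<^sub>R ?v) / (1 + s)" using s by (simp add: hom)
    finally have a: "(1 + s) * lo \<le> p (?u + s *\<^sub>R ?v)" using s by (simp add: field_simps)
    have "lo \<le> p (w2 - (y + s *\<^sub>R ?v))" using k1 w2 sub by blast
    then have b: "lo \<le> p (?u - s *\<^sub>R ?v)" by (simp add: diff_diff_add)
    have nn: "0 \<le> p ?u" using k0[of w2] w2 sub lohi by force
    have "((1 + s) * lo)\<^sup>2 + lo\<^sup>2 \<le> (p (?u + s *\<^sub>R ?v))\<^sup>2 + (p (?u - s *\<^sub>R ?v))\<^sup>2"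
      using a b s lohi by (intro add_mono power_mono) auto
    also have "\<dots> \<le> A * (max (p ?u) (p ?v))\<^sup>2" by (rule bound)
    also have "\<dots> \<le> A * hi\<^sup>2"
      using A w1 w2 nn by (intro mult_left_mono power_mono) auto
    finally have "((1 + s) * lo)\<^sup>2 + lo\<^sup>2 \<le> A * hi\<^sup>2" .
    moreover have "((1 + s) * lo)\<^sup>2 + lo\<^sup>2 = \<Theta>\<^sup>2 * (B * (1 - \<kappa>)\<^sup>2)"
      by (simp add: B_def lo_def power2_eq_square algebra_simps)
    moreover have "A * hi\<^sup>2 = \<Theta>\<^sup>2 * (A * (1 + \<kappa>)\<^sup>2)"
      by (simp add: hi_def power_mult_distrib)
    ultimately have "\<Theta>\<^sup>2 * (B * (1 - \<kappa>)\<^sup>2) \<le> \<Theta>\<^sup>2 * (A * (1 + \<kappa>)\<^sup>2)" by simp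
    then show ?thesis using \<Theta> by (simp add: mult_le_cancel_left)
  qed
  have "B \<le> A"
  proof (rule tendsto_le)
    show "((\<lambda>\<kappa>. A * (1 + \<kappa>)\<^sup>2) \<longlongrightarrow> A) (at_right 0)"
      by (rule tendsto_eq_intros refl | simp)+
    show "((\<lambda>\<kappa>. B * (1 - \<kappa>)\<^sup>2) \<longlongrightarrow> B) (at_right 0)"
      by (rule tendsto_eq_intros refl | simp)+
    show "\<forall>\<^sub>F \<kappa> in at_right 0. B * (1 - \<kappa>)\<^sup>2 \<le> A * (1 + \<kappa>)\<^sup>2"
      using eventually_at_right_real[of 0 1] by (rule eventually_mono) (use key in auto)
  qed simp
  with A show False by (simp add: B_def)
qed

text \<open>The bound forces \<open>p\<close> to be at most \<open>\<rho> < 1\<close> at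
  \<open>(e n - e m) - s (e n - b)\<close> for all \<open>n > m\<close>. This condition is convex in
  \<open>e n\<close>, so it holds with \<open>e n\<close> replaced by a point \<open>w\<close> of
  the tail hull. For \<open>w = b\<close> the vector would be \<open>b - e m\<close>, where
  \<open>p\<close> is at least 1; a \<open>w\<close> close to \<open>b\<close> is enough for a
  contradiction.\<close>

lemma no_diametral_sequence:
  fixes p :: "'v::real_vector \<Rightarrow> real" and e :: "nat \<Rightarrow> 'v"
  assumes tri: "\<And>u v. p (u + v) \<le> p u + p v" and hom: "\<And>c u. p (c *\<^sub>R u) = \<bar>c\<bar> * p u"
    and s: "0 \<le> s" "s \<le> 1" and A: "0 \<le> A" "A < 1 + (1 + s)\<^sup>2"
    and bound: "\<And>u v. (p (u + s *\<^sub>R v))\<^sup>2 + (p (u - s *\<^sub>R v))\<^sup>2 \<le> A * (max (p u) (p v))\<^sup>2"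
    and diam: "\<And>i j. p (e i - e j) \<le> 1"
    and far: "\<And>n c. c \<in> convex hull (e ` {..<n}) \<Longrightarrow> 1 \<le> p (e n - c)"
  shows False
proof -
  let ?D = "\<lambda>k. convex hull (e ` {k..})"
  have p_minus: "p (- u) = p u" for u using hom[of "-1" u] by simp
  have nonneg: "0 \<le> p u" for u
    using tri[of u "- u"] hom[of 0 u] p_minus[of u] by simp
  \<comment> \<open>What the bound leaves for \<open>p (u - s v)\<close> once
    \<open>p (u + s v)\<close> is at least \<open>1 + s\<close> and \<open>u\<close>,
    \<open>v\<close> lie in the unit ball.\<close>
  define \<rho> where "\<rho> = sqrt (max 0 (A - (1 + s)\<^sup>2))"
  have \<rho>: "\<rho> < 1" using A by (simp add: \<rho>_def)
  \<comment> \<open>Half the gap: two points within \<open>\<eta>\<close> of \<open>y\<close> are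
    less than \<open>1 - \<rho>\<close> apart.\<close>
  define \<eta> where "\<eta> = (1 - \<rho>) / 2"
  have \<eta>: "0 < \<eta>" using \<rho> by (simp add: \<eta>_def)
  obtain y where y: "\<And>k. \<exists>w\<in>?D k. p (w - y) < \<eta>"
    using tails_have_approximate_center[of p s A e \<eta>, OF tri hom s(1) A bound diam \<eta>] by blast
  obtain b where b: "b \<in> ?D 0" "p (b - y) < \<eta>" using y by blast
  \<comment> \<open>A convex combination involves finitely many terms. All of them precede some
    index \<open>m\<close>, so \<open>far\<close> applies to \<open>e m\<close> and
    \<open>b\<close>.\<close>
  have "\<exists>m. b \<in> convex hull (e ` {..<m})"
  proof -
    obtain F f where F: "finite F" "F \<subseteq> range e"
      and f: "\<forall>x\<in>F. 0 \<le> f x" "sum f F = 1" "(\<Sum>x\<in>F. f x *\<^sub>R x) = b"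
      using b(1) unfolding atLeast_0 convex_hull_explicit by auto
    have bF: "b \<in> convex hull F" using f unfolding convex_hull_finite[OF F(1)] by blast
    obtain I where "finite I" "F = e ` I" using F finite_subset_image[of F e UNIV] by auto
    moreover obtain m where "I \<subseteq> {..<m}" using \<open>finite I\<close> finite_nat_iff_bounded by auto
    ultimately show ?thesis using bF hull_mono[of F "e ` {..<m}" convex] by blast
  qed
  then obtain m where m: "b \<in> convex hull (e ` {..<m})" by blast
  \<comment> \<open>Starting at \<open>Suc m\<close> gives every \<open>e n\<close> of this tail an
    index \<open>n > m\<close>, as \<open>step\<close> requires.\<close>
  obtain w where w: "w \<in> ?D (Suc m)" "p (w - y) < \<eta>" using y by blast
  have step: "p ((1 - s) *\<^sub>R e n + (s *\<^sub>R b - e m)) \<le> \<rho>" if n: "m < n" for n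
  proof -
    let ?u = "e n - e m" and ?v = "e n - b"
    have "convex hull (e ` {..<m}) \<subseteq> {z. p ((-1) *\<^sub>R z + e n) \<le> 1}"
      using diam by (intro hull_minimal convex_seminorm_le tri hom) auto
    then have v: "p ?v \<le> 1" using m by auto
    have "b \<in> convex hull (e ` {..<n})"
      using n by (intro subsetD[OF hull_mono[OF image_mono] m]) auto
    moreover have "e m \<in> convex hull (e ` {..<n})"
      using n by (simp add: hull_inc)
    ultimately have "(1 / (1 + s)) *\<^sub>R e m + (s / (1 + s)) *\<^sub>R b \<in> convex hull (e ` {..<n})"
      using s by (intro convexD convex_convex_hull) (auto simp: field_simps)
    then have "1 \<le> p (e n - ((1 / (1 + s)) *\<^sub>R e m + (s / (1 + s)) *\<^sub>R b))" by (rule far)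
    also have "e n - ((1 / (1 + s)) *\<^sub>R e m + (s / (1 + s)) *\<^sub>R b) =
        (1 / (1 + s) + s / (1 + s)) *\<^sub>R e n - ((1 / (1 + s)) *\<^sub>R e m + (s / (1 + s)) *\<^sub>R b)"
      using s by (simp add: add_divide_distrib[symmetric])
    also have "\<dots> = (1 / (1 + s)) *\<^sub>R (?u + s *\<^sub>R ?v)"
      by (simp add: algebra_simps)
    also have "p \<dots> = p (?u + s *\<^sub>R ?v) / (1 + s)" using s by (simp add: hom)
    finally have a: "1 + s \<le> p (?u + s *\<^sub>R ?v)" using s by (simp add: field_simps)
    have "(1 + s)\<^sup>2 + (p (?u - s *\<^sub>R ?v))\<^sup>2 \<le> (p (?u + s *\<^sub>R ?v))\<^sup>2 + (p (?u - s *\<^sub>R ?v))\<^sup>2"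
      using power_mono[OF a, of 2] s by simp
    also have "\<dots> \<le> A * (max (p ?u) (p ?v))\<^sup>2" by (rule bound)
    also have "\<dots> \<le> A * 1\<^sup>2"
      using A v diam nonneg by (intro mult_left_mono power_mono) (auto simp: le_max_iff_disj)
    finally have "p (?u - s *\<^sub>R ?v) \<le> \<rho>"
      unfolding \<rho>_def by (intro real_le_rsqrt) simp
    then show ?thesis by (simp add: algebra_simps)
  qed
  have "?D (Suc m) \<subseteq> {z. p ((1 - s) *\<^sub>R z + (s *\<^sub>R b - e m)) \<le> \<rho>}"
    using step by (intro hull_minimal convex_seminorm_le tri hom) auto
  then have 1: "p ((1 - s) *\<^sub>R w + (s *\<^sub>R b - e m)) \<le> \<rho>" using w by auto
  have "p (b - w) \<le> p (b - y) + p (y - w)" using tri[of "b - y" "y - w"] by simp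
  also have "\<dots> < 1 - \<rho>" using b w p_minus[of "w - y"] by (simp add: \<eta>_def)
  finally have 2: "p (b - w) < 1 - \<rho>" .
  have "1 \<le> p (e m - b)" by (rule far[OF m])
  also have "\<dots> = p (((1 - s) *\<^sub>R w + (s *\<^sub>R b - e m)) + (1 - s) *\<^sub>R (b - w))"
    using p_minus[of "e m - b"] by (simp add: algebra_simps)
  also have "\<dots> \<le> \<rho> + (1 - s) * p (b - w)"
    using tri[of "(1 - s) *\<^sub>R w + (s *\<^sub>R b - e m)" "(1 - s) *\<^sub>R (b - w)"] 1 s by (simp add: hom)
  also have "\<dots> \<le> \<rho> + 1 * p (b - w)"
    using s nonneg by (intro add_left_mono mult_right_mono) auto
  finally show False using 2 by simp
qed

section \<open>Limits of norms and a criterion for uniform normal structure\<close>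

text \<open>A cluster point of the evaluations, obtained from Tychonoff's theorem: an ultraproduct norm
  without the ultrafilter.\<close>

lemma limit_seminorm_exists:
  obtains p :: "(nat \<Rightarrow>\<^sub>C 'a::real_normed_vector) \<Rightarrow> real"
  where "\<And>C. closed C \<Longrightarrow> \<forall>\<^sub>F N in sequentially. (\<lambda>\<xi>. norm (apply_bcontfun \<xi> N)) \<in> C \<Longrightarrow> p \<in> C"
proof -
  \<comment> \<open>Bounded continuous functions on the discrete space \<open>nat\<close> are the
    bounded sequences. \<open>?P N\<close> takes the norm of the \<open>N\<close>-th term and lies
    in the product \<open>?U\<close> of compact intervals.\<close>
  let ?P = "\<lambda>N \<xi>. norm (apply_bcontfun \<xi> N :: 'a)"
  let ?U = "Pi\<^sub>E UNIV (\<lambda>\<xi>. {0..norm \<xi>}) :: ((nat \<Rightarrow>\<^sub>C 'a) \<Rightarrow> real) set"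
  have "compactin (product_topology (\<lambda>_. euclidean) UNIV) ?U"
    by (simp add: compactin_PiE)
  then have "compact ?U"
    by (simp add: euclidean_product_topology)
  moreover have "\<forall>\<^sub>F q in filtermap ?P sequentially. q \<in> ?U"
    by (simp add: eventually_filtermap norm_bounded PiE_iff)
  moreover have "filtermap ?P sequentially \<noteq> bot"
    by (simp add: filtermap_bot_iff)
  ultimately obtain p where p: "inf (nhds p) (filtermap ?P sequentially) \<noteq> bot"
    unfolding compact_filter by blast
  show thesis
  proof (rule that, rule ccontr)
    fix C assume C: "closed C" "\<forall>\<^sub>F N in sequentially. ?P N \<in> C" and "p \<notin> C"
    then have "\<forall>\<^sub>F q in nhds p. q \<in> - C"
      by (intro eventually_nhds_in_open) auto
    moreover have "\<forall>\<^sub>F q in filtermap ?P sequentially. q \<in> C"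
      using C by (simp add: eventually_filtermap)
    ultimately have "\<forall>\<^sub>F q in inf (nhds p) (filtermap ?P sequentially). False"
      unfolding eventually_inf by blast
    with p show False by (simp add: trivial_limit_def)
  qed
qed

text \<open>Each term is chosen far from the mean of its predecessors. Since no distance exceeds \<open>d\<close>, it is then
  far from every convex combination of them.\<close>

lemma approximately_diametral_sequence:
  fixes K :: "'a::real_normed_vector set"
  assumes K: "convex K" "k \<in> K" and d: "0 < d"
    and diam: "\<And>x y. x \<in> K \<Longrightarrow> y \<in> K \<Longrightarrow> norm (x - y) \<le> d"
    and far: "\<And>x. x \<in> K \<Longrightarrow> \<exists>y\<in>K. (1 - \<eta>) * d \<le> norm (x - y)"
  obtains x :: "nat \<Rightarrow> 'a"
  where "x 0 = 0" "\<And>i j. norm (x i - x j) \<le> 1"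
    "\<And>n c. c \<in> convex hull (x ` {..<n}) \<Longrightarrow> 1 - real n * \<eta> \<le> norm (x n - c)"
proof -
  obtain g where g: "\<And>x. x \<in> K \<Longrightarrow> g x \<in> K" "\<And>x. x \<in> K \<Longrightarrow> (1 - \<eta>) * d \<le> norm (x - g x)"
    using far by metis
  \<comment> \<open>\<open>a n\<close> is the mean of \<open>y 0, ..., y n\<close>, updated
    recursively, and \<open>y (Suc n)\<close> is a point of \<open>K\<close> far from it.\<close>
  define a where "a = rec_nat k (\<lambda>n a. (1 / real (n + 2)) *\<^sub>R (real (n + 1) *\<^sub>R a + g a))"
  define y where "y = case_nat k (\<lambda>n. g (a n))"
  have a_0: "a 0 = k" and a_Suc: "a (Suc n) = (1 / real (n + 2)) *\<^sub>R (real (n + 1) *\<^sub>R a n + g (a n))" for n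
    by (simp_all add: a_def)
  have y_0: "y 0 = k" and y_Suc: "y (Suc n) = g (a n)" for n
    by (simp_all add: y_def)
  have aK: "a n \<in> K" for n
  proof (induction n)
    case 0
    then show ?case using K by (simp add: a_0)
  next
    case (Suc n)
    have "(real (n + 1) / real (n + 2)) *\<^sub>R a n + (1 / real (n + 2)) *\<^sub>R g (a n) \<in> K"
      using Suc g K by (intro convexD) (auto simp: add_divide_distrib[symmetric])
    then show ?case by (simp add: a_Suc scaleR_add_right)
  qed
  have yK: "y n \<in> K" for n
    using K g aK by (cases n) (auto simp: y_0 y_Suc)
  have mean: "real (Suc n) *\<^sub>R a n = (\<Sum>i\<le>n. y i)" for n
  proof (induction n)
    case (Suc n)
    have "real (Suc (Suc n)) *\<^sub>R a (Suc n) = real (n + 1) *\<^sub>R a n + g (a n)"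
      by (simp add: a_Suc)
    then show ?case using Suc by (simp add: y_Suc)
  qed (simp add: a_0 y_0)
  have y_far: "(1 - real n * \<eta>) * d \<le> norm (y n - c)" if c: "c \<in> convex hull (y ` {..<n})" for n c
  proof (cases n)
    case 0
    then show ?thesis using c by simp
  next
    case (Suc m)
    let ?z = "y n" and ?S = "\<Sum>i\<le>m. y i"
    \<comment> \<open>Subtracting \<open>y j\<close> leaves \<open>m\<close> differences
      \<open>y i - ?z\<close> of norm at most \<open>d\<close>. One ball, with a centre independent
      of \<open>j\<close>, thus contains all predecessors of \<open>?z\<close>, hence also
      \<open>c\<close>.\<close>
    have "y j \<in> cball (?S - real m *\<^sub>R ?z) (real m * d)" if j: "j \<le> m" for j
    proof -
      have "?S - real m *\<^sub>R ?z - y j = (\<Sum>i\<in>{..m} - {j}. y i - ?z)"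
        using j by (simp add: sum_subtractf sum_diff1 sum_constant_scaleR)
      also have "norm \<dots> \<le> (\<Sum>i\<in>{..m} - {j}. d)"
        using yK diam by (intro sum_norm_le) auto
      finally show ?thesis using j by (simp add: dist_norm)
    qed
    then have "convex hull (y ` {..<n}) \<subseteq> cball (?S - real m *\<^sub>R ?z) (real m * d)"
      using Suc by (intro hull_minimal) auto
    then have 1: "norm (?S - real m *\<^sub>R ?z - c) \<le> real m * d"
      using c by (auto simp: dist_norm)
    \<comment> \<open>With \<open>n = m + 1\<close>, \<open>n\<close> times the distance from the
      mean is at most \<open>m d\<close> plus the distance to \<open>c\<close>, which leaves
      \<open>(1 - n \<eta>) d\<close> for the latter.\<close>
    have "real n * ((1 - \<eta>) * d) \<le> real n * norm (a m - ?z)"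
      using g(2)[OF aK[of m]] Suc by (intro mult_left_mono) (auto simp: y_Suc)
    also have "\<dots> = norm (real n *\<^sub>R (a m - ?z))" by simp
    also have "real n *\<^sub>R (a m - ?z) = (?S - real m *\<^sub>R ?z - c) - (?z - c)"
      using mean[of m] Suc by (simp add: algebra_simps)
    also have "norm \<dots> \<le> real m * d + norm (?z - c)"
      using norm_triangle_ineq4[of "?S - real m *\<^sub>R ?z - c" "?z - c"] 1 by linarith
    finally show ?thesis using Suc by (simp add: algebra_simps)
  qed
  \<comment> \<open>Moving \<open>k\<close> to the origin bounds every term by 1 in norm.\<close>
  define x where "x n = (1 / d) *\<^sub>R y n + (- (1 / d)) *\<^sub>R k" for n
  show thesis
  proof
    show "x 0 = 0" by (simp add: x_def y_0)
    have x_diff: "x i - x j = (1 / d) *\<^sub>R (y i - y j)" for i j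
      by (simp add: x_def algebra_simps)
    show "norm (x i - x j) \<le> 1" for i j
      using diam[OF yK yK] d by (simp add: x_diff)
    show "1 - real n * \<eta> \<le> norm (x n - c)" if c: "c \<in> convex hull (x ` {..<n})" for n c
    proof -
      have "x ` {..<n} = (\<lambda>z. (- (1 / d)) *\<^sub>R k + (1 / d) *\<^sub>R z) ` (y ` {..<n})"
        unfolding x_def image_image by (simp only: add.commute)
      then obtain b where b: "b \<in> convex hull (y ` {..<n})" "c = (- (1 / d)) *\<^sub>R k + (1 / d) *\<^sub>R b"
        using c unfolding \<open>x ` {..<n} = _\<close> convex_hull_affinity by blast
      then have "x n - c = (1 / d) *\<^sub>R (y n - b)"
        by (simp add: x_def algebra_simps)
      then have "norm (x n - c) = norm (y n - b) / d" using d by simp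
      then show ?thesis using y_far[OF b(1)] d by (simp add: le_divide_eq)
    qed
  qed
qed

text \<open>A sequence \<open>x N\<close> is taken for each error \<open>\<eta> N\<close>, and then
  \<open>N\<close> tends to infinity. The bound is a closed condition on finitely many norms, so it
  survives in the limit, where the error \<open>n \<eta> N\<close> has disappeared for each fixed
  \<open>n\<close>.\<close>

lemma uniform_normal_structureI:
  fixes s A :: real
  assumes s: "0 \<le> s" "s \<le> 1" and A: "0 \<le> A" "A < 1 + (1 + s)\<^sup>2"
    and bound: "\<And>u v :: 'a::real_normed_vector.
      (norm (u + s *\<^sub>R v))\<^sup>2 + (norm (u - s *\<^sub>R v))\<^sup>2 \<le> A * (max (norm u) (norm v))\<^sup>2"
  shows "uniform_normal_structure TYPE('a)"
proof (rule ccontr)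
  assume nuns: "\<not> uniform_normal_structure TYPE('a)"
  \<comment> \<open>Larger than \<open>1 / (N + 2)\<close>, by which the constant refuted below
    differs from 1: the strict gap turns a bound on a supremum into a point of
    \<open>K\<close>.\<close>
  define \<eta> where "\<eta> N = 2 * inverse (real (Suc N))" for N
  define good where "good N x \<longleftrightarrow> x 0 = 0 \<and> (\<forall>i j. norm (x i - x j) \<le> 1) \<and>
      (\<forall>n. \<forall>c\<in>convex hull (x ` {..<n}). 1 - real n * \<eta> N \<le> norm (x n - c))"
    for N and x :: "nat \<Rightarrow> 'a"
  have "\<exists>x. good N x" for N
  proof -
    let ?c = "1 - 1 / real (N + 2)"
    have c: "0 < ?c" "?c < 1" by (auto simp: field_simps)
    obtain K :: "'a set" where K: "bounded K" "convex K" and xy: "\<exists>x\<in>K. \<exists>y\<in>K. x \<noteq> y"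
      and *: "\<And>x. x \<in> K \<Longrightarrow> ?c * diameter K \<le> (SUP y\<in>K. norm (x - y))"
      using nuns c unfolding uniform_normal_structure_def by (meson not_le)
    obtain k l where kl: "k \<in> K" "l \<in> K" "k \<noteq> l" using xy by blast
    have diam: "norm (x - y) \<le> diameter K" if "x \<in> K" "y \<in> K" for x y
      using diameter_bounded_bound[OF K(1) that] by (simp add: dist_norm)
    have d: "0 < diameter K"
      using diam[of k l] kl less_le_trans[of 0 "norm (k - l)"] by simp
    have "\<exists>y\<in>K. (1 - \<eta> N) * diameter K \<le> norm (x - y)" if x: "x \<in> K" for x
    proof -
      have "(1 - \<eta> N) * diameter K < ?c * diameter K"
        using d by (auto simp: \<eta>_def field_simps intro!: add_nonneg_pos)
      also have "\<dots> \<le> (SUP y\<in>K. norm (x - y))" by (rule *[OF x])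
      finally show ?thesis
        using x less_cSUP_iff[OF _ bdd_aboveI2[of K "\<lambda>y. norm (x - y)", OF diam[OF x]]]
        by (blast intro: less_imp_le)
    qed
    then obtain x :: "nat \<Rightarrow> 'a" where "x 0 = 0" "\<And>i j. norm (x i - x j) \<le> 1"
      "\<And>n c. c \<in> convex hull (x ` {..<n}) \<Longrightarrow> 1 - real n * \<eta> N \<le> norm (x n - c)"
      using approximately_diametral_sequence[OF K(2) kl(1) d diam] by blast
    then show ?thesis unfolding good_def by blast
  qed
  then obtain x where x: "\<And>N. good N (x N)" by metis
  have x0: "x N 0 = 0" and x1: "norm (x N i - x N j) \<le> 1" for N i j
    using x[of N] unfolding good_def by blast+
  have x_far: "1 - real n * \<eta> N \<le> norm (x N n - c)" if "c \<in> convex hull (x N ` {..<n})" for N n c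
    using x[of N] that unfolding good_def by blast
  \<comment> \<open>Transposition: the \<open>n\<close>-th terms of all the sequences form one
    bounded function of \<open>N\<close>.\<close>
  define e where "e n = Bcontfun (\<lambda>N. x N n)" for n
  have e_apply: "apply_bcontfun (e n) N = x N n" for n N
  proof -
    have "(\<lambda>N. x N n) \<in> bcontfun"
      using x1[of _ n 0] x0 by (intro bcontfun_normI[where b=1]) auto
    then show ?thesis by (simp add: e_def Bcontfun_inverse)
  qed
  obtain p :: "(nat \<Rightarrow>\<^sub>C 'a) \<Rightarrow> real"
    where p: "\<And>C. closed C \<Longrightarrow> \<forall>\<^sub>F N in sequentially. (\<lambda>\<xi>. norm (apply_bcontfun \<xi> N)) \<in> C \<Longrightarrow> p \<in> C"
    using limit_seminorm_exists by blast
  \<comment> \<open>Each condition below depends continuously on finitely many coordinates of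
    \<open>q\<close>, so it is closed in the product topology.\<close>
  note cont = closed_Collect_le closed_Collect_eq continuous_on_add continuous_on_max
    continuous_on_power continuous_on_mult_left continuous_on_const continuous_on_product_coordinates
  show False
  proof (rule no_diametral_sequence[of p s A e])
    fix u v
    have "p \<in> {q. q (u + v) \<le> q u + q v}"
      by (intro p cont always_eventually) (auto simp: plus_bcontfun.rep_eq norm_triangle_ineq)
    then show "p (u + v) \<le> p u + p v" by simp
    have "p \<in> {q. (q (u + s *\<^sub>R v))\<^sup>2 + (q (u - s *\<^sub>R v))\<^sup>2 \<le> A * (max (q u) (q v))\<^sup>2}"
      using bound by (intro p cont always_eventually)
        (auto simp: plus_bcontfun.rep_eq minus_bcontfun.rep_eq scaleR_bcontfun.rep_eq)
    then show "(p (u + s *\<^sub>R v))\<^sup>2 + (p (u - s *\<^sub>R v))\<^sup>2 \<le> A * (max (p u) (p v))\<^sup>2" by simp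
  next
    fix c u
    have "p \<in> {q. q (c *\<^sub>R u) = \<bar>c\<bar> * q u}"
      by (intro p cont always_eventually) (auto simp: scaleR_bcontfun.rep_eq)
    then show "p (c *\<^sub>R u) = \<bar>c\<bar> * p u" by simp
  next
    fix i j
    have "p \<in> {q. q (e i - e j) \<le> 1}"
      by (intro p cont always_eventually) (auto simp: minus_bcontfun.rep_eq e_apply x1)
    then show "p (e i - e j) \<le> 1" by simp
  next
    fix n c assume c: "c \<in> convex hull (e ` {..<n})"
    have lin: "linear (\<lambda>\<xi>. apply_bcontfun \<xi> N :: 'a)" for N
      by (intro linearI) (auto simp: plus_bcontfun.rep_eq scaleR_bcontfun.rep_eq)
    have cN: "apply_bcontfun c N \<in> convex hull (x N ` {..<n})" for N
      using in_convex_hull_linear_image[OF lin[of N] c] by (simp add: image_image e_apply)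
    have "1 - \<epsilon> \<le> p (e n - c)" if \<epsilon>: "0 < \<epsilon>" for \<epsilon>
    proof -
      have "(\<lambda>N. real n * \<eta> N) \<longlonglongrightarrow> 0"
        unfolding \<eta>_def
        by (intro tendsto_mult_right_zero LIMSEQ_inverse_real_of_nat)
      then have "\<forall>\<^sub>F N in sequentially. real n * \<eta> N < \<epsilon>"
        using \<epsilon> by (rule order_tendstoD)
      then have "\<forall>\<^sub>F N in sequentially. (\<lambda>\<xi>. norm (apply_bcontfun \<xi> N)) \<in> {q. 1 - \<epsilon> \<le> q (e n - c)}"
      proof eventually_elim
        case (elim N)
        then show ?case using x_far[OF cN[of N]] by (simp add: minus_bcontfun.rep_eq e_apply)
      qed
      then have "p \<in> {q. 1 - \<epsilon> \<le> q (e n - c)}" by (intro p cont)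
      then show ?thesis by simp
    qed
    then show "1 \<le> p (e n - c)"
      unfolding diff_le_eq by (rule field_le_epsilon)
  qed (use s A in auto)
qed

section \<open>\<open>L_const\<close> as a supremum over unit vectors, and part (i)\<close>

text \<open>Isosceles orthogonality gives \<open>x + y\<close> and \<open>x - y\<close> the same
  norm, so one division turns both into unit vectors \<open>u\<close>, \<open>v\<close>. The
  quotient is scale invariant, and the 4 is the square of the factor in
  \<open>u - s v = 2 (t x + (1 - t) y)\<close>.\<close>

lemma L_const_eq_Sup:
  "L_const TYPE('a::real_normed_vector) t =
    Sup {((norm (u + (1 - 2 * t) *\<^sub>R v))\<^sup>2 + (norm (u - (1 - 2 * t) *\<^sub>R v))\<^sup>2) / 4
      | u v :: 'a. norm u = 1 \<and> norm v = 1}"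
    (is "_ = Sup ?R")
  unfolding L_const_def
proof (rule arg_cong[where f = Sup], intro equalityI subsetI)
  let ?s = "1 - 2 * t"
  fix r
  assume "r \<in> {((norm (t *\<^sub>R x + (1 - t) *\<^sub>R y))\<^sup>2 + (norm ((1 - t) *\<^sub>R x + t *\<^sub>R y))\<^sup>2) / (norm (x + y))\<^sup>2
         | x y :: 'a. (x, y) \<noteq> (0, 0) \<and> x \<bottom>\<^sub>I y}"
  then obtain x y :: 'a where ne: "(x, y) \<noteq> (0, 0)" and iso: "norm (x + y) = norm (x - y)"
    and r: "r = ((norm (t *\<^sub>R x + (1 - t) *\<^sub>R y))\<^sup>2 + (norm ((1 - t) *\<^sub>R x + t *\<^sub>R y))\<^sup>2) / (norm (x + y))\<^sup>2"
    unfolding isosceles_orth_def by blast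
  define m where "m = norm (x + y)"
  have m: "0 < m"
  proof (rule ccontr)
    assume "\<not> 0 < m"
    then have "x + y = 0" "x - y = 0" using iso by (auto simp: m_def)
    then have "2 *\<^sub>R x = 0" "y = x" by (auto simp: scaleR_2)
    then show False using ne by simp
  qed
  define u v where "u = (1 / m) *\<^sub>R (x + y)" and "v = (1 / m) *\<^sub>R (x - y)"
  have uv: "norm u = 1" "norm v = 1" using m iso by (auto simp: u_def v_def m_def)
  have sums: "u + ?s *\<^sub>R v = (2 / m) *\<^sub>R ((1 - t) *\<^sub>R x + t *\<^sub>R y)"
    and diffs: "u - ?s *\<^sub>R v = (2 / m) *\<^sub>R (t *\<^sub>R x + (1 - t) *\<^sub>R y)"
    by (simp_all add: u_def v_def algebra_simps add_divide_distrib[symmetric] diff_divide_distrib[symmetric]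
        scaleR_add_left[symmetric] scaleR_diff_left[symmetric])
  then have "r = ((norm (u + ?s *\<^sub>R v))\<^sup>2 + (norm (u - ?s *\<^sub>R v))\<^sup>2) / 4"
    unfolding sums diffs norm_scaleR r m_def[symmetric] using m
    by (simp add: power_mult_distrib power_divide add_divide_distrib)
  then show "r \<in> ?R" using uv by blast
next
  let ?s = "1 - 2 * t"
  fix r assume "r \<in> ?R"
  then obtain u v :: 'a where uv: "norm u = 1" "norm v = 1"
    and r: "r = ((norm (u + ?s *\<^sub>R v))\<^sup>2 + (norm (u - ?s *\<^sub>R v))\<^sup>2) / 4" by blast
  define x y where "x = (1/2) *\<^sub>R (u + v)" and "y = (1/2) *\<^sub>R (u - v)"
  have xy: "x + y = u" "x - y = v"
    by (simp_all add: x_def y_def algebra_simps scaleR_add_left[symmetric])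
  have "u + ?s *\<^sub>R v = 2 *\<^sub>R ((1 - t) *\<^sub>R x + t *\<^sub>R y)"
    and "u - ?s *\<^sub>R v = 2 *\<^sub>R (t *\<^sub>R x + (1 - t) *\<^sub>R y)"
    unfolding xy[symmetric] by (simp_all add: algebra_simps scaleR_2)
  then have "r = ((norm (t *\<^sub>R x + (1 - t) *\<^sub>R y))\<^sup>2 + (norm ((1 - t) *\<^sub>R x + t *\<^sub>R y))\<^sup>2) / (norm (x + y))\<^sup>2"
    unfolding r xy using uv by (simp add: power_mult_distrib)
  moreover have "(x, y) \<noteq> (0, 0)" "x \<bottom>\<^sub>I y"
    using xy uv by (auto simp: isosceles_orth_def)
  ultimately show "r \<in> {((norm (t *\<^sub>R x + (1 - t) *\<^sub>R y))\<^sup>2 + (norm ((1 - t) *\<^sub>R x + t *\<^sub>R y))\<^sup>2) / (norm (x + y))\<^sup>2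
         | x y :: 'a. (x, y) \<noteq> (0, 0) \<and> x \<bottom>\<^sub>I y}" by blast
qed

lemma sum_squares_unit_le:
  fixes u v :: "'a::real_normed_vector"
  assumes "norm u = 1" "norm v = 1" "0 \<le> s"
  shows "((norm (u + s *\<^sub>R v))\<^sup>2 + (norm (u - s *\<^sub>R v))\<^sup>2) / 4 \<le> (1 + s)\<^sup>2 / 2"
proof -
  have "norm (u + s *\<^sub>R v) \<le> 1 + s" "norm (u - s *\<^sub>R v) \<le> 1 + s"
    using norm_triangle_ineq[of u "s *\<^sub>R v"] norm_triangle_ineq4[of u "s *\<^sub>R v"] assms by auto
  then have "(norm (u + s *\<^sub>R v))\<^sup>2 \<le> (1 + s)\<^sup>2" "(norm (u - s *\<^sub>R v))\<^sup>2 \<le> (1 + s)\<^sup>2"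
    by (intro power_mono; simp)+
  then show ?thesis by simp
qed

lemma L_const_ge:
  fixes u v :: "'a::real_normed_vector"
  assumes "norm u = 1" "norm v = 1" "t \<le> 1/2"
  shows "((norm (u + (1 - 2 * t) *\<^sub>R v))\<^sup>2 + (norm (u - (1 - 2 * t) *\<^sub>R v))\<^sup>2) / 4 \<le> L_const TYPE('a) t"
  unfolding L_const_eq_Sup
proof (rule cSup_upper)
  show "bdd_above {((norm (u + (1 - 2 * t) *\<^sub>R v))\<^sup>2 + (norm (u - (1 - 2 * t) *\<^sub>R v))\<^sup>2) / 4
      | u v :: 'a. norm u = 1 \<and> norm v = 1}"
    using assms(3)
    by (intro bdd_aboveI[where M = "(1 + (1 - 2 * t))\<^sup>2 / 2"]) (clarify, rule sum_squares_unit_le, auto)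
qed (use assms in blast)

text \<open>Some unit vectors have both \<open>norm (u + v)\<close> and \<open>norm (u - v)\<close>
  near 2. Replacing \<open>v\<close> by \<open>s v\<close> loses at most \<open>1 - s\<close>, so
  both norms come near \<open>1 + s\<close>, the most that the triangle inequality permits.\<close>

lemma L_const_not_uniformly_non_square:
  assumes nsq: "\<not> uniformly_non_square TYPE('a::real_normed_vector)" and t: "0 \<le> t" "t < 1/2"
  shows "L_const TYPE('a) t = 2 * t\<^sup>2 - 4 * t + 2"
proof -
  define s where "s = 1 - 2 * t"
  have s: "0 < s" "s \<le> 1" using t by (auto simp: s_def)
  have near: "\<exists>u v :: 'a. norm u = 1 \<and> norm v = 1 \<and> 2 * (1 - \<delta>) < norm (u + v) \<and> 2 * (1 - \<delta>) < norm (u - v)"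
    if \<delta>: "0 < \<delta>" "\<delta> < 1" for \<delta>
    using nsq \<delta> unfolding uniformly_non_square_def by (force simp: not_le)
  have "L_const TYPE('a) t = (1 + s)\<^sup>2 / 2"
  proof (rule antisym)
    obtain u0 v0 :: 'a where "norm u0 = 1" "norm v0 = 1" using near[of "1/2"] by auto
    then show "L_const TYPE('a) t \<le> (1 + s)\<^sup>2 / 2"
      unfolding L_const_eq_Sup s_def[symmetric]
      using s by (intro cSup_least) (blast, clarify, rule sum_squares_unit_le, auto)
    have "(1 + s - 2 * \<delta>)\<^sup>2 / 2 \<le> L_const TYPE('a) t" if \<delta>: "0 < \<delta>" "\<delta> < 1/2" for \<delta>
    proof -
      obtain u v :: 'a where uv: "norm u = 1" "norm v = 1"
        "2 * (1 - \<delta>) < norm (u + v)" "2 * (1 - \<delta>) < norm (u - v)"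
        using near[of \<delta>] \<delta> by auto
      have r: "norm ((1 - s) *\<^sub>R v) = 1 - s" using s uv by simp
      have "norm (u + v) \<le> norm (u + s *\<^sub>R v) + (1 - s)"
        using norm_triangle_ineq[of "u + s *\<^sub>R v" "(1 - s) *\<^sub>R v"] unfolding r by (simp add: algebra_simps)
      moreover have "norm (u - v) \<le> norm (u - s *\<^sub>R v) + (1 - s)"
        using norm_triangle_ineq4[of "u - s *\<^sub>R v" "(1 - s) *\<^sub>R v"] unfolding r by (simp add: algebra_simps)
      ultimately have "1 + s - 2 * \<delta> \<le> norm (u + s *\<^sub>R v)" "1 + s - 2 * \<delta> \<le> norm (u - s *\<^sub>R v)"
        using uv by auto
      then have "(1 + s - 2 * \<delta>)\<^sup>2 \<le> (norm (u + s *\<^sub>R v))\<^sup>2" "(1 + s - 2 * \<delta>)\<^sup>2 \<le> (norm (u - s *\<^sub>R v))\<^sup>2"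
        using \<delta> s by (simp_all add: power_mono)
      then have "((1 + s - 2 * \<delta>)\<^sup>2 + (1 + s - 2 * \<delta>)\<^sup>2) / 4
          \<le> ((norm (u + s *\<^sub>R v))\<^sup>2 + (norm (u - s *\<^sub>R v))\<^sup>2) / 4"
        by (intro divide_right_mono add_mono) simp_all
      also have "\<dots> \<le> L_const TYPE('a) t"
        using L_const_ge[OF uv(1,2) less_imp_le[OF t(2)]] unfolding s_def[symmetric] .
      finally show ?thesis by simp
    qed
    then have "\<forall>\<^sub>F \<delta> in at_right 0. (1 + s - 2 * \<delta>)\<^sup>2 / 2 \<le> L_const TYPE('a) t"
      using eventually_at_right_real[of 0 "1/2"] by (auto elim!: eventually_mono)
    moreover have "((\<lambda>\<delta>. (1 + s - 2 * \<delta>)\<^sup>2 / 2) \<longlongrightarrow> (1 + s)\<^sup>2 / 2) (at_right 0)"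
      by (rule tendsto_eq_intros refl | simp)+
    ultimately show "(1 + s)\<^sup>2 / 2 \<le> L_const TYPE('a) t"
      by (intro tendsto_upperbound) auto
  qed
  then show ?thesis by (simp add: s_def power2_eq_square algebra_simps)
qed

section \<open>From unit vectors to the unit ball; parts (ii) and (iii)\<close>

text \<open>The left-hand side is convex and even in \<open>\<tau>\<close>.\<close>

lemma sum_squares_scale_le:
  fixes a b :: "'a::real_normed_vector"
  assumes "0 \<le> \<tau>" "\<tau> \<le> 1"
  shows "(norm (a + \<tau> *\<^sub>R b))\<^sup>2 + (norm (a - \<tau> *\<^sub>R b))\<^sup>2 \<le> (norm (a + b))\<^sup>2 + (norm (a - b))\<^sup>2"
proof -
  \<comment> \<open>With these weights, in opposite orders, \<open>a + \<tau> b\<close> and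
    \<open>a - \<tau> b\<close> are convex combinations of \<open>a + b\<close> and
    \<open>a - b\<close>.\<close>
  define \<alpha> \<beta> A B where "\<alpha> = (1 + \<tau>) / 2" and "\<beta> = (1 - \<tau>) / 2"
    and "A = norm (a + b)" and "B = norm (a - b)"
  have ab: "0 \<le> \<alpha>" "0 \<le> \<beta>" "\<alpha> + \<beta> = 1" "\<alpha> - \<beta> = \<tau>" and AB: "0 \<le> A" "0 \<le> B"
    using assms by (auto simp: \<alpha>_def \<beta>_def A_def B_def field_simps)
  have "a + \<tau> *\<^sub>R b = (\<alpha> + \<beta>) *\<^sub>R a + (\<alpha> - \<beta>) *\<^sub>R b" using ab by simp
  also have "\<dots> = \<alpha> *\<^sub>R (a + b) + \<beta> *\<^sub>R (a - b)" by (simp add: algebra_simps)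
  also have "norm \<dots> \<le> \<alpha> * A + \<beta> * B"
    using norm_triangle_ineq[of "\<alpha> *\<^sub>R (a + b)" "\<beta> *\<^sub>R (a - b)"] ab by (simp add: A_def B_def)
  finally have 1: "(norm (a + \<tau> *\<^sub>R b))\<^sup>2 \<le> (\<alpha> * A + \<beta> * B)\<^sup>2" by (rule power_mono) simp
  have "a - \<tau> *\<^sub>R b = (\<alpha> + \<beta>) *\<^sub>R a - (\<alpha> - \<beta>) *\<^sub>R b" using ab by simp
  also have "\<dots> = \<beta> *\<^sub>R (a + b) + \<alpha> *\<^sub>R (a - b)" by (simp add: algebra_simps)
  also have "norm \<dots> \<le> \<beta> * A + \<alpha> * B"
    using norm_triangle_ineq[of "\<beta> *\<^sub>R (a + b)" "\<alpha> *\<^sub>R (a - b)"] ab by (simp add: A_def B_def)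
  finally have 2: "(norm (a - \<tau> *\<^sub>R b))\<^sup>2 \<le> (\<beta> * A + \<alpha> * B)\<^sup>2" by (rule power_mono) simp
  have "A\<^sup>2 + B\<^sup>2 - ((\<alpha> * A + \<beta> * B)\<^sup>2 + (\<beta> * A + \<alpha> * B)\<^sup>2) = 2 * (\<alpha> * \<beta>) * (A - B)\<^sup>2"
    unfolding \<alpha>_def \<beta>_def by (simp add: power2_eq_square field_simps)
  moreover have "0 \<le> 2 * (\<alpha> * \<beta>) * (A - B)\<^sup>2" using ab by simp
  ultimately show ?thesis using 1 2 unfolding A_def[symmetric] B_def[symmetric] by linarith
qed

text \<open>The supremum only controls vectors of equal norm. Stretching the shorter one to the
  length of the longer does not decrease the sum of squares.\<close>

lemma sum_squares_le_L_const:
  fixes u v :: "'a::real_normed_vector"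
  assumes t: "t \<le> 1/2"
  shows "(norm (u + (1 - 2 * t) *\<^sub>R v))\<^sup>2 + (norm (u - (1 - 2 * t) *\<^sub>R v))\<^sup>2
    \<le> 4 * L_const TYPE('a) t * (max (norm u) (norm v))\<^sup>2"
proof (cases "u = 0 \<and> v = 0")
  case False
  define s r where "s = 1 - 2 * t" and "r = max (norm u) (norm v)"
  have r: "0 < r" using False by (auto simp: r_def less_max_iff_disj)
  have eq: "(norm (a + s *\<^sub>R b))\<^sup>2 + (norm (a - s *\<^sub>R b))\<^sup>2 \<le> 4 * L_const TYPE('a) t * r\<^sup>2"
    if ab: "norm a = r" "norm b = r" for a b :: 'a
  proof -
    have "a + s *\<^sub>R b = r *\<^sub>R ((1 / r) *\<^sub>R a + s *\<^sub>R (1 / r) *\<^sub>R b)"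
      and "a - s *\<^sub>R b = r *\<^sub>R ((1 / r) *\<^sub>R a - s *\<^sub>R (1 / r) *\<^sub>R b)"
      using r by (simp_all add: algebra_simps)
    then have "(norm (a + s *\<^sub>R b))\<^sup>2 + (norm (a - s *\<^sub>R b))\<^sup>2 = r\<^sup>2 *
      ((norm ((1 / r) *\<^sub>R a + s *\<^sub>R (1 / r) *\<^sub>R b))\<^sup>2 + (norm ((1 / r) *\<^sub>R a - s *\<^sub>R (1 / r) *\<^sub>R b))\<^sup>2)"
      by (simp only: norm_scaleR power_mult_distrib power2_abs distrib_left)
    also have "\<dots> \<le> r\<^sup>2 * (4 * L_const TYPE('a) t)"
      using L_const_ge[of "(1 / r) *\<^sub>R a" "(1 / r) *\<^sub>R b" t] t ab r
      unfolding s_def[symmetric] by (intro mult_left_mono) auto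
    finally show ?thesis by (simp add: mult_ac)
  qed
  have polar: "\<exists>\<tau> w'. 0 \<le> \<tau> \<and> \<tau> \<le> 1 \<and> norm w' = r \<and> w = \<tau> *\<^sub>R w'"
    if w: "norm w \<le> r" and z: "norm z = r" for w z :: 'a
  proof (cases "w = 0")
    case True
    then show ?thesis using z by (intro exI[of _ 0] exI[of _ z]) auto
  next
    case False
    then show ?thesis using w r
      by (intro exI[of _ "norm w / r"] exI[of _ "(r / norm w) *\<^sub>R w"]) auto
  qed
  have "(norm (u + s *\<^sub>R v))\<^sup>2 + (norm (u - s *\<^sub>R v))\<^sup>2 \<le> 4 * L_const TYPE('a) t * r\<^sup>2"
  proof (cases "norm u \<le> norm v")
    case True
    then have v: "norm v = r" "norm u \<le> r" by (auto simp: r_def)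
    then obtain \<tau> w where \<tau>: "0 \<le> \<tau>" "\<tau> \<le> 1" and w: "norm w = r" "u = \<tau> *\<^sub>R w"
      using polar by blast
    \<comment> \<open>Exchanging the two vectors preserves both norms, so the shorter
      \<open>u\<close> can be the one that is stretched.\<close>
    have "(norm (u + s *\<^sub>R v))\<^sup>2 + (norm (u - s *\<^sub>R v))\<^sup>2
        = (norm (s *\<^sub>R v + \<tau> *\<^sub>R w))\<^sup>2 + (norm (s *\<^sub>R v - \<tau> *\<^sub>R w))\<^sup>2"
      by (simp add: w add.commute norm_minus_commute)
    also have "\<dots> \<le> (norm (s *\<^sub>R v + w))\<^sup>2 + (norm (s *\<^sub>R v - w))\<^sup>2"
      by (rule sum_squares_scale_le[OF \<tau>])
    also have "\<dots> = (norm (w + s *\<^sub>R v))\<^sup>2 + (norm (w - s *\<^sub>R v))\<^sup>2"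
      by (simp add: add.commute norm_minus_commute)
    also have "\<dots> \<le> 4 * L_const TYPE('a) t * r\<^sup>2" using w v by (intro eq)
    finally show ?thesis .
  next
    case False
    then have u: "norm u = r" "norm v \<le> r" by (auto simp: r_def)
    then obtain \<tau> w where \<tau>: "0 \<le> \<tau>" "\<tau> \<le> 1" and w: "norm w = r" "v = \<tau> *\<^sub>R w"
      using polar by blast
    have "(norm (u + s *\<^sub>R v))\<^sup>2 + (norm (u - s *\<^sub>R v))\<^sup>2
        = (norm (u + \<tau> *\<^sub>R s *\<^sub>R w))\<^sup>2 + (norm (u - \<tau> *\<^sub>R s *\<^sub>R w))\<^sup>2"
      by (simp add: w mult.commute)
    also have "\<dots> \<le> (norm (u + s *\<^sub>R w))\<^sup>2 + (norm (u - s *\<^sub>R w))\<^sup>2"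
      by (rule sum_squares_scale_le[OF \<tau>])
    also have "\<dots> \<le> 4 * L_const TYPE('a) t * r\<^sup>2" using w u by (intro eq)
    finally show ?thesis .
  qed
  then show ?thesis unfolding s_def r_def .
qed simp

lemma uniform_normal_structure_if_L_const_less:
  assumes t: "0 \<le> t" "t < 1/2" and L: "L_const TYPE('a::real_normed_vector) t < (4 * t\<^sup>2 - 8 * t + 5) / 4"
    and z: "(z::'a) \<noteq> 0"
  shows "uniform_normal_structure TYPE('a)"
proof (rule uniform_normal_structureI)
  \<comment> \<open>With \<open>s = 1 - 2 t\<close>, the threshold \<open>1 + (1 + s)^2\<close> is
    \<open>4 t^2 - 8 t + 5\<close>.\<close>
  show "4 * L_const TYPE('a) t < 1 + (1 + (1 - 2 * t))\<^sup>2"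
    using L by (simp add: power2_eq_square algebra_simps)
  have "0 \<le> ((norm (sgn z + (1 - 2 * t) *\<^sub>R sgn z))\<^sup>2 + (norm (sgn z - (1 - 2 * t) *\<^sub>R sgn z))\<^sup>2) / 4"
    by simp
  also have "\<dots> \<le> L_const TYPE('a) t"
    using z t by (intro L_const_ge) (auto simp: norm_sgn)
  finally show "0 \<le> 4 * L_const TYPE('a) t" by simp
qed (use t sum_squares_le_L_const[of t] in auto)

lemma uniform_normal_structure_imp_normal_structure:
  assumes "uniform_normal_structure TYPE('a::real_normed_vector)"
  shows "normal_structure TYPE('a)"
proof -
  obtain c :: real where c: "0 < c" "c < 1"
    and *: "\<forall>K :: 'a set. closed K \<and> bounded K \<and> convex K \<and> (\<exists>x\<in>K. \<exists>y\<in>K. x \<noteq> y) \<longrightarrow>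
      (\<exists>x\<in>K. (SUP y\<in>K. norm (x - y)) < c * diameter K)"
    using assms unfolding uniform_normal_structure_def by (elim exE conjE) (rule that)
  show ?thesis
    unfolding normal_structure_def
  proof (intro allI impI)
    fix K :: "'a set"
    assume K: "closed K \<and> bounded K \<and> convex K \<and> (\<exists>x\<in>K. \<exists>y\<in>K. x \<noteq> y)"
    then obtain x where x: "x \<in> K" "(SUP y\<in>K. norm (x - y)) < c * diameter K"
      using *[rule_format, OF K] by blast
    have "c * diameter K \<le> diameter K"
      using c K diameter_ge_0[of K] by (simp add: mult_left_le_one_le)
    with x show "\<exists>x\<in>K. (SUP y\<in>K. norm (x - y)) < diameter K" by force
  qed
qed

theorem theorem9:
  assumes dim_ge_2: "\<exists>B :: 'a::banach set. independent B \<and> card B = 2"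
  shows "(\<not> uniformly_non_square TYPE('a) \<longrightarrow>
            (\<forall>t. 0 \<le> t \<and> t < 1/2 \<longrightarrow> L_const TYPE('a) t = 2 * t\<^sup>2 - 4 * t + 2)) \<and>
         ((\<exists>t\<^sub>0. 0 \<le> t\<^sub>0 \<and> t\<^sub>0 < 1/2 \<and> L_const TYPE('a) t\<^sub>0 < (4 * t\<^sub>0\<^sup>2 - 8 * t\<^sub>0 + 5) / 4) \<longrightarrow>
            uniform_normal_structure TYPE('a)) \<and>
         ((\<exists>t\<^sub>0. 0 \<le> t\<^sub>0 \<and> t\<^sub>0 < 1/2 \<and> L_const TYPE('a) t\<^sub>0 < 9 * (1 - 2 * t\<^sub>0)\<^sup>2 / 8) \<longrightarrow>
            normal_structure TYPE('a))"
proof -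
  obtain B :: "'a set" where "independent B" "card B = 2" using dim_ge_2 by blast
  then obtain z :: 'a where z: "z \<noteq> 0"
    unfolding card_2_iff by (metis dependent_zero insertI1 insertI2)
  have uns: "uniform_normal_structure TYPE('a)"
    if "0 \<le> t" "t < 1/2" "L_const TYPE('a) t < (4 * t\<^sup>2 - 8 * t + 5) / 4" for t
    using uniform_normal_structure_if_L_const_less[OF that z] .
  have "9 * (1 - 2 * t)\<^sup>2 / 8 \<le> (4 * t\<^sup>2 - 8 * t + 5) / 4" if t: "0 \<le> t" "t < 1/2" for t :: real
  proof -
    \<comment> \<open>The sides of the next inequality differ by \<open>1 + 20 t - 28 t^2\<close>,
      which \<open>t^2 \<le> t / 2\<close> makes at least \<open>1 + 6 t\<close>.\<close>
    have "t * t \<le> t * (1/2)" using t by (intro mult_left_mono) auto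
    then have "9 * (1 - 2 * t)\<^sup>2 \<le> 2 * (4 * t\<^sup>2 - 8 * t + 5)"
      using t by (simp add: power2_eq_square algebra_simps)
    then show ?thesis by simp
  qed
  then have "normal_structure TYPE('a)"
    if "0 \<le> t" "t < 1/2" "L_const TYPE('a) t < 9 * (1 - 2 * t)\<^sup>2 / 8" for t
    using uns[of t] that by (intro uniform_normal_structure_imp_normal_structure) (meson less_le_trans)
  with uns L_const_not_uniformly_non_square show ?thesis by blast
qed

end
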